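(* For every finite group $G$, $$r_{\mathcal I}(\mathcal A_G)=\left\lceil\log_2\bigl(1+\Delta^+_{\rm sub}(G)\bigr)\right\rceil.$$
   Context: For a finite group $G$, $\mathcal A_G$ is the variety of left $G$-sets with a named constant $c$: its signature has unary operations $\lambda_g$ ($g\in G$) and a constant $c$, with identities $\lambda_1(x)=x$ and $\lambda_g(\lambda_h(x))=\lambda_{gh}(x)$; no identity involving $c$ is imposed (in particular $c$ need not be fixed by the action). For $S\subseteq G$ put $S^{\leqslant q}=\bigcup_{j=0}^q S^j$, where $S^0=\{1\}$ and $S^j$ is the set of products of $j$ elements of $S$. If $H=\langle S\rangle$, let $d^+(H,S)=\min\{q\geqslant0\mid S^{\leqslant q}=H\}$ (the positive diameter), and let $$\Delta^+_{\rm sub}(G)=\max\{d^+(H,S)\mid H\leqslant G,\ S\subseteq H,\ \langle S\rangle=H\}.$$ A semicongruence on an algebra $A$ is a reflexive binary relation on $A$ which is a subalgebra of $A\times A$. For $A\in\mathcal A_G$ and $I\subseteq A$, let $R_I$ be the least semicongruence containing $I\times\{c\}$, and put $\mathcal I_c(I)=\{x\in A\mid x\,R_I\,y\text{ for some }y\in I\}$. Write $\mathcal I_c^n$ for the $n$-fold iterate (the relation being regenerated from the current set at every step), with $\mathcal I_c^0$ the identity operator. The inductive rank $r_{\mathcal I}(\mathcal A_G)$, taken at $c$, is the least integer $n\ge 0$ such that $\mathcal I_c^n(I)=\mathcal I_c^{n+1}(I)$ for every non-empty subset $I$ of every $A\in\mathcal A_G$ (and $\infty$ if there is none). *)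

theory Defs
  imports "HOL-Algebra.Algebra" "HOL-Library.Extended_Nat" Complex_Main
begin

section \<open>Left G-sets with a named constant\<close>

text \<open>
  The operation indexed by g is \<open>act g\<close>; its values are only relevant for g in the
  carrier of G and arguments in the carrier set \<open>A\<close>.
\<close>

locale pointed_gset = group G for G :: "('a, 'm) monoid_scheme" (structure) +
  fixes A :: "'b set" and act :: "'a \<Rightarrow> 'b \<Rightarrow> 'b" and c :: 'b
  assumes act_closed: "\<lbrakk>g \<in> carrier G; x \<in> A\<rbrakk> \<Longrightarrow> act g x \<in> A"
    and const_closed: "c \<in> A"
    and act_one: "x \<in> A \<Longrightarrow> act \<one> x = x"
    and act_act: "\<lbrakk>g \<in> carrier G; h \<in> carrier G; x \<in> A\<rbrakk> \<Longrightarrow> act g (act h x) = act (g \<otimes> h) x"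

definition gset_subalgebra ::
    "('a, 'm) monoid_scheme \<Rightarrow> 'b set \<Rightarrow> ('a \<Rightarrow> 'b \<Rightarrow> 'b) \<Rightarrow> 'b \<Rightarrow> 'b set \<Rightarrow> bool" where
  "gset_subalgebra G A act c B \<longleftrightarrow>
     B \<subseteq> A \<and> c \<in> B \<and> (\<forall>g\<in>carrier G. \<forall>x\<in>B. act g x \<in> B)"

definition semicongruence ::
    "('a, 'm) monoid_scheme \<Rightarrow> 'b set \<Rightarrow> ('a \<Rightarrow> 'b \<Rightarrow> 'b) \<Rightarrow> 'b \<Rightarrow> 'b rel \<Rightarrow> bool" where
  "semicongruence G A act c R \<longleftrightarrow>
     refl_on A R \<and> gset_subalgebra G (A \<times> A) (\<lambda>g. map_prod (act g) (act g)) (c, c) R"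

definition gen_semicongruence ::
    "('a, 'm) monoid_scheme \<Rightarrow> 'b set \<Rightarrow> ('a \<Rightarrow> 'b \<Rightarrow> 'b) \<Rightarrow> 'b \<Rightarrow> 'b set \<Rightarrow> 'b rel" where
  "gen_semicongruence G A act c I = \<Inter> {R. semicongruence G A act c R \<and> I \<times> {c} \<subseteq> R}"

definition ind_op ::
    "('a, 'm) monoid_scheme \<Rightarrow> 'b set \<Rightarrow> ('a \<Rightarrow> 'b \<Rightarrow> 'b) \<Rightarrow> 'b \<Rightarrow> 'b set \<Rightarrow> 'b set" where
  "ind_op G A act c I = {x \<in> A. \<exists>y\<in>I. (x, y) \<in> gen_semicongruence G A act c I}"

text \<open>
  HOL cannot quantify over the carriers of all types at once, so the rank takes the type
  \<open>'b\<close> in which the carriers live as a parameter. It should be used with infinite \<open>'b\<close>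
  only: a finite \<open>'b\<close> may omit (isomorphic copies of) algebras needed to attain the rank.
  The infimum of the empty set of extended naturals is \<open>\<infinity>\<close>.
\<close>

definition inductive_rank :: "'b itself \<Rightarrow> ('a, 'm) monoid_scheme \<Rightarrow> enat" where
  "inductive_rank (T :: 'b itself) G =
     Inf (enat ` {n. \<forall>(A :: 'b set) act c I. pointed_gset G A act c \<longrightarrow> I \<subseteq> A \<longrightarrow> I \<noteq> {} \<longrightarrow>
       (ind_op G A act c ^^ n) I = (ind_op G A act c ^^ (n + 1)) I})"

section \<open>Positive diameters\<close>

primrec set_pow :: "('a, 'm) monoid_scheme \<Rightarrow> 'a set \<Rightarrow> nat \<Rightarrow> 'a set" where
  "set_pow G S 0 = {\<one>\<^bsub>G\<^esub>}"
| "set_pow G S (Suc j) = S <#>\<^bsub>G\<^esub> set_pow G S j"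

definition set_pow_le :: "('a, 'm) monoid_scheme \<Rightarrow> 'a set \<Rightarrow> nat \<Rightarrow> 'a set" where
  "set_pow_le G S q = (\<Union>j\<le>q. set_pow G S j)"

text \<open>For finite \<open>H\<close> generated by \<open>S\<close> the minimum exists; otherwise the value may be arbitrary.\<close>

definition pos_diameter :: "('a, 'm) monoid_scheme \<Rightarrow> 'a set \<Rightarrow> 'a set \<Rightarrow> nat" where
  "pos_diameter G H S = (LEAST q. set_pow_le G S q = H)"

definition max_sub_pos_diameter :: "('a, 'm) monoid_scheme \<Rightarrow> nat" where
  "max_sub_pos_diameter G =
     Max {pos_diameter G H S | H S. subgroup H G \<and> S \<subseteq> H \<and> generate G S = H}"

section \<open>Sanity checks\<close>

text \<open>
  Up to the extensionality convention for \<^const>\<open>BijGroup\<close>, these are the group actions of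
  the library together with a point.
\<close>

lemma (in pointed_gset) group_action_restrict:
  "group_action G A (\<lambda>g. restrict (act g) A)"
proof -
  have bij: "bij_betw (act g) A A" if g: "g \<in> carrier G" for g
    by (rule bij_betw_byWitness[where f' = "act (inv g)"])
      (use g in \<open>auto simp: act_act act_one act_closed\<close>)
  have "(\<lambda>g. restrict (act g) A) \<in> hom G (BijGroup A)"
  proof (rule homI)
    fix g assume "g \<in> carrier G"
    then show "restrict (act g) A \<in> carrier (BijGroup A)"
      using bij by (auto simp: BijGroup_def Bij_def)
  next
    fix g h assume gh: "g \<in> carrier G" "h \<in> carrier G"
    then have "restrict (act g) A \<in> Bij A" "restrict (act h) A \<in> Bij A"
      using bij by (auto simp: Bij_def)
    then show "restrict (act (g \<otimes> h)) A =
        restrict (act g) A \<otimes>\<^bsub>BijGroup A\<^esub> restrict (act h) A"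
      using gh by (auto simp: BijGroup_def compose_def act_act act_closed fun_eq_iff)
  qed
  then show ?thesis
    by (simp add: group_action_def group_hom_def group_hom_axioms_def group_axioms group_BijGroup)
qed

lemma pointed_gset_of_group_action:
  assumes "group_action G A \<phi>" and "c \<in> A"
  shows "pointed_gset G A \<phi> c"
proof -
  interpret group_action G A \<phi> by (rule assms)
  interpret group G using group_hom group_hom.axioms(1) by blast
  show ?thesis
  proof
    show "\<phi> g x \<in> A" if "g \<in> carrier G" "x \<in> A" for g x
      using element_image that by blast
    show "c \<in> A" by (rule assms)
    show "\<phi> \<one>\<^bsub>G\<^esub> x = x" if "x \<in> A" for x
      using id_eq_one that by (metis restrict_apply')
    show "\<phi> g (\<phi> h x) = \<phi> (g \<otimes>\<^bsub>G\<^esub> h) x"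
      if "g \<in> carrier G" "h \<in> carrier G" "x \<in> A" for g h x
      using composition_rule that by simp
  qed
qed

lemma (in pointed_gset) semicongruence_gen_semicongruence:
  assumes "I \<subseteq> A"
  shows "semicongruence G A act c (gen_semicongruence G A act c I)"
    and "I \<times> {c} \<subseteq> gen_semicongruence G A act c I"
proof -
  have "semicongruence G A act c (A \<times> A)"
    by (auto simp: semicongruence_def gset_subalgebra_def refl_on_def act_closed const_closed)
  moreover have "I \<times> {c} \<subseteq> A \<times> A" using assms const_closed by auto
  ultimately have "gen_semicongruence G A act c I \<subseteq> A \<times> A"
    unfolding gen_semicongruence_def by (intro Inter_lower) simp
  then show "semicongruence G A act c (gen_semicongruence G A act c I)"
    unfolding semicongruence_def gset_subalgebra_def
    by (auto simp: gen_semicongruence_def semicongruence_def gset_subalgebra_def refl_on_def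
        map_prod_def split: prod.splits)
  show "I \<times> {c} \<subseteq> gen_semicongruence G A act c I"
    by (auto simp: gen_semicongruence_def)
qed

end

theory Submission
  imports Defs
begin

text \<open>
  The semicongruence generated by \<open>I \<times> {c}\<close> consists of the diagonal and the pairs
  \<open>(g i, g c)\<close>. Hence one application of the operator enlarges \<open>I\<close> to \<open>I \<union> T I\<close>, where
  \<open>T\<close> is the set of group elements that carry \<open>c\<close> into \<open>I\<close>. As \<open>T\<close> depends on the current
  set, it grows too, from \<open>T\<close> to \<open>T \<union> T T\<close>, so that word lengths double at every step:
  the n-th iterate is \<open>W I\<close>, where \<open>W\<close> collects the products of at most
  \<open>2 ^ n - 1\<close> elements of the initial \<open>T\<close> (\<open>ind_op_iterate\<close>).

  These products exhaust the subgroup generated by \<open>T\<close> as soon as \<open>2 ^ n - 1\<close> reaches the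
  positive diameter, and from then on the iterates are constant. Conversely, a generating
  set \<open>S\<close> of a subgroup of maximal positive diameter is realised on two disjoint regular
  orbits, those of \<open>c\<close> and of another point \<open>d\<close>, by \<open>I = S c \<union> {d}\<close>: the first orbit gives
  \<open>T = S\<close>, while the trace of the iterates on the second one is a faithful copy of the sets
  of products, which grow strictly until they fill the subgroup
  (\<open>set_pow_le_eq_generate\<close>). Thus the n-th iterates are always stationary if and only if
  the maximal diameter is at most \<open>2 ^ n - 1\<close>.
\<close>

section \<open>Products of bounded length in a finite group\<close>

context group
begin

lemma set_pow_carrier: "S \<subseteq> carrier G \<Longrightarrow> set_pow G S j \<subseteq> carrier G"
  by (induction j) (auto intro: set_mult_closed[THEN subsetD])

lemma set_pow_le_carrier: "S \<subseteq> carrier G \<Longrightarrow> set_pow_le G S q \<subseteq> carrier G"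
  using set_pow_carrier unfolding set_pow_le_def by blast

lemma set_pow_add:
  assumes "S \<subseteq> carrier G"
  shows "set_pow G S (i + j) = set_pow G S i <#> set_pow G S j"
proof (induction i)
  case 0
  show ?case using set_pow_carrier[OF assms, of j] by (force simp: set_mult_def)
next
  case (Suc i)
  then show ?case using assms by (simp add: set_mult_assoc set_pow_carrier)
qed

lemma set_pow_one: "S \<subseteq> carrier G \<Longrightarrow> set_pow G S 1 = S"
  by (force simp: set_mult_def)

lemma one_in_set_pow_le: "\<one> \<in> set_pow_le G S q"
  unfolding set_pow_le_def by force

lemma set_pow_le_mono: "p \<le> q \<Longrightarrow> set_pow_le G S p \<subseteq> set_pow_le G S q"
  unfolding set_pow_le_def by (meson UN_mono atMost_subset_iff subset_refl)

text \<open>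
  A product of at most \<open>2 q + 1\<close> factors either has at most \<open>q\<close> of them or can be cut around
  a middle factor, with at most \<open>q\<close> factors on each side.
\<close>

lemma set_pow_le_double:
  assumes S: "S \<subseteq> carrier G"
  shows "set_pow_le G S (2 * q + 1) =
    set_pow_le G S q \<union> (set_pow_le G S q <#> S <#> set_pow_le G S q)"
proof -
  have cut: "set_pow G S i <#> S <#> set_pow G S j = set_pow G S (i + 1 + j)" for i j
    using S by (simp only: set_pow_add set_pow_one)
  have prod: "set_pow_le G S q <#> S <#> set_pow_le G S q =
      (\<Union>i\<le>q. \<Union>j\<le>q. set_pow G S (i + 1 + j))"
    unfolding cut[symmetric] set_pow_le_def set_mult_def by blast
  show ?thesis
  proof
    show "set_pow_le G S (2 * q + 1) \<subseteq>
        set_pow_le G S q \<union> (set_pow_le G S q <#> S <#> set_pow_le G S q)"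
    proof
      fix x assume "x \<in> set_pow_le G S (2 * q + 1)"
      then obtain k where k: "k \<le> 2 * q + 1" "x \<in> set_pow G S k"
        by (auto simp: set_pow_le_def)
      show "x \<in> set_pow_le G S q \<union> (set_pow_le G S q <#> S <#> set_pow_le G S q)"
      proof (cases "k \<le> q")
        case True
        then have "x \<in> set_pow_le G S q" using k(2) by (auto simp: set_pow_le_def)
        then show ?thesis by blast
      next
        case False
        then have "k = q + 1 + (k - q - 1)" "k - q - 1 \<le> q" using k by auto
        then show ?thesis using k(2) unfolding prod by (metis UN_iff UnI2 atMost_iff order_refl)
      qed
    qed
    have "set_pow G S (i + 1 + j) \<subseteq> set_pow_le G S (2 * q + 1)" if "i \<le> q" "j \<le> q" for i j
    proof -
      have "i + 1 + j \<le> 2 * q + 1" using that by simp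
      then show ?thesis unfolding set_pow_le_def by blast
    qed
    then show "set_pow_le G S q \<union> (set_pow_le G S q <#> S <#> set_pow_le G S q)
        \<subseteq> set_pow_le G S (2 * q + 1)"
      unfolding prod using set_pow_le_mono[of q "2 * q + 1" S] by auto
  qed
qed

lemma set_pow_subset_generate: "S \<subseteq> carrier G \<Longrightarrow> set_pow G S j \<subseteq> generate G S"
  by (induction j) (auto simp: set_mult_def intro: generate.intros)

lemma set_pow_le_subset_generate: "S \<subseteq> carrier G \<Longrightarrow> set_pow_le G S q \<subseteq> generate G S"
  using set_pow_subset_generate unfolding set_pow_le_def by blast

lemma nat_pow_in_set_pow: "s \<in> S \<Longrightarrow> S \<subseteq> carrier G \<Longrightarrow> s [^] j \<in> set_pow G S j"
proof (induction j)
  case (Suc j)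
  then have "s [^] Suc j = s \<otimes> s [^] j" by (intro nat_pow_Suc2) auto
  then show ?case using Suc by (auto simp: set_mult_def simp del: nat_pow_Suc)
qed simp

text \<open>
  Inverses come for free: in a finite group the inverse of \<open>s\<close> is a power of \<open>s\<close> with a
  non-negative exponent.
\<close>

lemma generate_eq_Union_set_pow:
  assumes S: "S \<subseteq> carrier G" and fin: "finite (carrier G)"
  shows "generate G S = (\<Union>j. set_pow G S j)"
proof
  show "(\<Union>j. set_pow G S j) \<subseteq> generate G S"
    using set_pow_subset_generate[OF S] by blast
  show "generate G S \<subseteq> (\<Union>j. set_pow G S j)"
  proof
    fix x assume "x \<in> generate G S"
    then show "x \<in> (\<Union>j. set_pow G S j)"
    proof induction
      case one
      show ?case by (auto intro!: exI[of _ 0])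
    next
      case (incl h)
      then show ?case using set_pow_one[OF S] by blast
    next
      case (inv h)
      then have h: "h \<in> carrier G" using S by blast
      have pos: "0 < order G" using fin by (simp add: order_gt_0_iff_finite)
      have "h [^] (order G - 1) \<otimes> h = \<one>"
        using pow_order_eq_1[OF h] pos by (metis Suc_diff_1 nat_pow_Suc)
      then have "inv h = h [^] (order G - 1)"
        using h by (metis inv_equality nat_pow_closed)
      then show ?case using nat_pow_in_set_pow[OF inv S] by auto
    next
      case (eng g h)
      then obtain i j where "g \<in> set_pow G S i" "h \<in> set_pow G S j" by blast
      then have "g \<otimes> h \<in> set_pow G S (i + j)"
        unfolding set_pow_add[OF S] set_mult_def by blast
      then show ?case by blast
    qed
  qed
qed

text \<open>
  Once allowing longer products yields nothing new, the set of products is closed under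
  left multiplication by \<open>S\<close>. So the sets of products grow strictly until they fill the
  generated subgroup.
\<close>

lemma set_pow_le_eq_generate:
  assumes S: "S \<subseteq> carrier G" and fin: "finite (carrier G)"
    and "p < q" and eq: "set_pow_le G S p = set_pow_le G S q"
  shows "set_pow_le G S p = generate G S"
proof
  show "set_pow_le G S p \<subseteq> generate G S" by (rule set_pow_le_subset_generate[OF S])
  have step: "set_pow_le G S (Suc p) \<subseteq> set_pow_le G S p"
    unfolding eq using \<open>p < q\<close> by (intro set_pow_le_mono) simp
  have "set_pow G S j \<subseteq> set_pow_le G S p" for j
  proof (induction j)
    case 0
    show ?case using one_in_set_pow_le by simp
  next
    case (Suc j)
    have "set_pow G S (Suc j) \<subseteq> S <#> set_pow_le G S p"
      using Suc by (auto simp: set_mult_def)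
    also have "\<dots> \<subseteq> (\<Union>i\<le>p. set_pow G S (Suc i))"
      by (auto simp: set_mult_def set_pow_le_def)
    also have "\<dots> \<subseteq> set_pow_le G S (Suc p)"
      unfolding set_pow_le_def by (intro UN_least UN_upper) simp
    finally show ?case using step by blast
  qed
  then show "generate G S \<subseteq> set_pow_le G S p"
    unfolding generate_eq_Union_set_pow[OF S fin] by blast
qed

lemma set_pow_le_exhausts:
  assumes S: "S \<subseteq> carrier G" and fin: "finite (carrier G)"
  shows "\<exists>q. set_pow_le G S q = generate G S"
proof -
  have "range (set_pow_le G S) \<subseteq> Pow (carrier G)"
    using set_pow_le_carrier[OF S] by blast
  then have "finite (range (set_pow_le G S))"
    using fin by (meson finite_Pow_iff finite_subset)
  then have "\<not> inj (set_pow_le G S)" using finite_imageD by blast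
  then obtain p q where "p < q" "set_pow_le G S p = set_pow_le G S q"
    unfolding inj_def by (metis linorder_neqE_nat)
  then show ?thesis using set_pow_le_eq_generate[OF S fin] by blast
qed

lemma pos_diameter_le_iff:
  assumes S: "S \<subseteq> carrier G" and fin: "finite (carrier G)"
  shows "pos_diameter G (generate G S) S \<le> q \<longleftrightarrow> set_pow_le G S q = generate G S"
proof
  have least: "set_pow_le G S (pos_diameter G (generate G S) S) = generate G S"
    unfolding pos_diameter_def by (rule LeastI_ex[OF set_pow_le_exhausts[OF S fin]])
  assume "pos_diameter G (generate G S) S \<le> q"
  then show "set_pow_le G S q = generate G S"
    using least set_pow_le_mono set_pow_le_subset_generate[OF S] by blast
qed (simp add: pos_diameter_def Least_le)

lemma max_sub_pos_diameter_le_iff: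
  assumes fin: "finite (carrier G)"
  shows "max_sub_pos_diameter G \<le> q \<longleftrightarrow>
    (\<forall>S \<subseteq> carrier G. set_pow_le G S q = generate G S)"
proof -
  have "subgroup H G \<and> S \<subseteq> H \<and> generate G S = H \<longleftrightarrow> S \<subseteq> carrier G \<and> H = generate G S"
    for H S
    using generate_is_subgroup[of S] subgroup.subset[of H G] generate.incl[of _ S G] by blast
  then have "{pos_diameter G H S | H S. subgroup H G \<and> S \<subseteq> H \<and> generate G S = H} =
      (\<lambda>S. pos_diameter G (generate G S) S) ` Pow (carrier G)" (is "_ = ?D")
    by auto
  then have "max_sub_pos_diameter G = Max ?D" by (simp add: max_sub_pos_diameter_def)
  moreover have "finite ?D" "?D \<noteq> {}" using fin by auto
  ultimately have "max_sub_pos_diameter G \<le> q \<longleftrightarrow> (\<forall>d \<in> ?D. d \<le> q)"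
    using Max_le_iff[of ?D q] by simp
  then show ?thesis using pos_diameter_le_iff[OF _ fin] by auto
qed

end

section \<open>Iterating the operator\<close>

definition translates :: "('a \<Rightarrow> 'b \<Rightarrow> 'b) \<Rightarrow> 'a set \<Rightarrow> 'b set \<Rightarrow> 'b set" where
  "translates act W I = (\<Union>g\<in>W. act g ` I)"

definition point_transporter ::
    "('a, 'm) monoid_scheme \<Rightarrow> ('a \<Rightarrow> 'b \<Rightarrow> 'b) \<Rightarrow> 'b \<Rightarrow> 'b set \<Rightarrow> 'a set" where
  "point_transporter G act c I = {g \<in> carrier G. act g c \<in> I}"

context pointed_gset
begin

lemma point_transporter_carrier: "point_transporter G act c I \<subseteq> carrier G"
  by (auto simp: point_transporter_def)

lemma translates_closed: "W \<subseteq> carrier G \<Longrightarrow> I \<subseteq> A \<Longrightarrow> translates act W I \<subseteq> A"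
  by (auto simp: translates_def intro: act_closed)

lemma translates_mult:
  assumes "V \<subseteq> carrier G" "W \<subseteq> carrier G" "I \<subseteq> A"
  shows "translates act V (translates act W I) = translates act (V <#> W) I"
proof -
  have "act g (act h x) = act (g \<otimes> h) x" if "g \<in> V" "h \<in> W" "x \<in> I" for g h x
    using that assms by (intro act_act) auto
  then show ?thesis unfolding translates_def set_mult_def by (force simp: image_iff)
qed

lemma gen_semicongruence_eq:
  assumes I: "I \<subseteq> A"
  shows "gen_semicongruence G A act c I =
    Id_on A \<union> {(act g x, act g c) | g x. g \<in> carrier G \<and> x \<in> I}" (is "_ = ?R")
proof
  have "semicongruence G A act c ?R"
    unfolding semicongruence_def gset_subalgebra_def
  proof (intro conjI ballI)
    show "refl_on A ?R" by (auto simp: refl_on_def)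
    show "?R \<subseteq> A \<times> A" using I by (auto intro: act_closed const_closed)
    show "(c, c) \<in> ?R" using const_closed by auto
    show "map_prod (act g) (act g) p \<in> ?R" if g: "g \<in> carrier G" and p: "p \<in> ?R" for g p
    proof (cases "p \<in> Id_on A")
      case True
      then show ?thesis using g act_closed by auto
    next
      case False
      then obtain h x where h: "h \<in> carrier G" "x \<in> I" "p = (act h x, act h c)"
        using p by auto
      then have "map_prod (act g) (act g) p = (act (g \<otimes> h) x, act (g \<otimes> h) c)"
        using g I const_closed act_act by auto
      then show ?thesis using g h by blast
    qed
  qed
  moreover have "I \<times> {c} \<subseteq> ?R"
  proof
    fix p assume "p \<in> I \<times> {c}"
    then obtain x where "p = (x, c)" "x \<in> I" by blast
    then have "(x, c) = (act \<one> x, act \<one> c)" using I const_closed act_one by auto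
    then show "p \<in> ?R" using \<open>p = (x, c)\<close> \<open>x \<in> I\<close> by blast
  qed
  ultimately show "gen_semicongruence G A act c I \<subseteq> ?R"
    unfolding gen_semicongruence_def by blast
next
  let ?S = "gen_semicongruence G A act c I"
  note S = semicongruence_gen_semicongruence[OF I]
  have "Id_on A \<subseteq> ?S"
    using S(1) by (auto simp: semicongruence_def refl_on_def)
  moreover have "(act g x, act g c) \<in> ?S" if "g \<in> carrier G" "x \<in> I" for g x
    using S that unfolding semicongruence_def gset_subalgebra_def
    by (metis (no_types, lifting) SigmaI insertI1 map_prod_simp subsetD)
  ultimately show "?R \<subseteq> ?S" by blast
qed

lemma ind_op_eq:
  assumes "I \<subseteq> A"
  shows "ind_op G A act c I = I \<union> translates act (point_transporter G act c I) I"
  using assms unfolding ind_op_def gen_semicongruence_eq[OF assms] translates_def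
    point_transporter_def by (auto intro: act_closed)

text \<open>\<open>g c = w i\<close> with \<open>i \<in> I\<close> says that \<open>inv w \<otimes> g\<close> carries \<open>c\<close> into \<open>I\<close>.\<close>

lemma point_transporter_translates:
  assumes W: "W \<subseteq> carrier G" and I: "I \<subseteq> A"
  shows "point_transporter G act c (translates act W I) = W <#> point_transporter G act c I"
proof
  show "point_transporter G act c (translates act W I) \<subseteq> W <#> point_transporter G act c I"
  proof
    fix g assume "g \<in> point_transporter G act c (translates act W I)"
    then obtain w i where g: "g \<in> carrier G" and w: "w \<in> W" and i: "i \<in> I"
      and eq: "act g c = act w i"
      by (auto simp: point_transporter_def translates_def)
    have wG: "w \<in> carrier G" and iA: "i \<in> A" using w i W I by auto
    have "act (inv w \<otimes> g) c = act (inv w) (act w i)"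
      using g wG const_closed act_act[of "inv w" g c] eq by simp
    also have "\<dots> = i" using wG iA by (simp add: act_act act_one)
    finally have "inv w \<otimes> g \<in> point_transporter G act c I"
      using i g wG by (simp add: point_transporter_def)
    moreover have "g = w \<otimes> (inv w \<otimes> g)" using g wG by (simp add: m_assoc[symmetric])
    ultimately show "g \<in> W <#> point_transporter G act c I"
      using w unfolding set_mult_def by blast
  qed
  show "W <#> point_transporter G act c I \<subseteq> point_transporter G act c (translates act W I)"
  proof
    fix g assume "g \<in> W <#> point_transporter G act c I"
    then obtain w t where wt: "w \<in> W" "t \<in> carrier G" "act t c \<in> I" "g = w \<otimes> t"
      by (auto simp: set_mult_def point_transporter_def)
    then have "w \<in> carrier G" using W by blast
    then have "act g c = act w (act t c)" using wt const_closed act_act by simp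
    then show "g \<in> point_transporter G act c (translates act W I)"
      using wt \<open>w \<in> carrier G\<close> by (auto simp: point_transporter_def translates_def)
  qed
qed

lemma ind_op_iterate:
  assumes I: "I \<subseteq> A"
  shows "(ind_op G A act c ^^ n) I =
    translates act (set_pow_le G (point_transporter G act c I) (2 ^ n - 1)) I"
proof (induction n)
  case 0
  have "act \<one> ` I = I" using I by (force simp: act_one)
  then show ?case by (simp add: translates_def set_pow_le_def)
next
  case (Suc n)
  let ?T = "point_transporter G act c I"
  define W where "W = set_pow_le G ?T (2 ^ n - 1)"
  have T: "?T \<subseteq> carrier G" by (rule point_transporter_carrier)
  have W: "W \<subseteq> carrier G" unfolding W_def by (rule set_pow_le_carrier[OF T])
  have WT: "W <#> ?T \<subseteq> carrier G" by (rule set_mult_closed[OF W T])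
  have "(2::nat) ^ Suc n - 1 = 2 * (2 ^ n - 1) + 1"
    using one_le_power[of "2::nat" n] unfolding power_Suc by linarith
  then have "set_pow_le G ?T (2 ^ Suc n - 1) = W \<union> (W <#> ?T <#> W)"
    by (simp only: set_pow_le_double[OF T] W_def)
  moreover have "(ind_op G A act c ^^ Suc n) I =
      translates act W I \<union> translates act (W <#> ?T) (translates act W I)"
    unfolding funpow.simps comp_apply Suc W_def[symmetric]
      ind_op_eq[OF translates_closed[OF W I]] point_transporter_translates[OF W I] ..
  ultimately show ?case
    unfolding translates_mult[OF WT W I] by (simp add: translates_def)
qed

end

section \<open>Two regular orbits\<close>

text \<open>
  The orbit of \<open>c\<close> serves to prescribe which group elements carry \<open>c\<close> into the initial set;
  the orbit of \<open>d\<close> serves to observe the iterates without interference from those points.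
  Two copies of the regular action fit into any infinite type.
\<close>

lemma (in group) ex_two_regular_orbits:
  assumes fin: "finite (carrier G)" and inf: "infinite (UNIV :: 'c set)"
  obtains A :: "'c set" and act c d where "pointed_gset G A act c" "d \<in> A"
    "inj_on (\<lambda>g. act g c) (carrier G)" "inj_on (\<lambda>g. act g d) (carrier G)"
    "\<And>g h. g \<in> carrier G \<Longrightarrow> h \<in> carrier G \<Longrightarrow> act g c \<noteq> act h d"
proof -
  define P where "P = carrier G \<times> (UNIV :: bool set)"
  have "finite P" using fin by (simp add: P_def)
  moreover obtain A :: "'c set" where "finite A" "card A = card P"
    using infinite_arbitrarily_large[OF inf] by blast
  ultimately obtain f where f: "bij_betw f P A" by (metis finite_same_card_bij)
  define act where "act g y = (case inv_into P f y of (h, b) \<Rightarrow> f (g \<otimes> h, b))" for g y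
  have act: "act g (f (h, b)) = f (g \<otimes> h, b)" if "h \<in> carrier G" for g h b
    using that bij_betw_inv_into_left[OF f, of "(h, b)"] by (simp add: act_def P_def)
  have A: "A = {f (h, b) | h b. h \<in> carrier G}"
    using f by (auto simp: bij_betw_def P_def)
  have f_eq: "f (g, a) = f (h, b) \<longleftrightarrow> g = h \<and> a = b"
    if "g \<in> carrier G" "h \<in> carrier G" for g h a b
    using f that unfolding bij_betw_def inj_on_def P_def by blast
  have "pointed_gset G A act (f (\<one>, False))"
    by unfold_locales (auto simp: A act m_assoc, blast+)
  moreover have "f (\<one>, True) \<in> A" by (auto simp: A)
  ultimately show thesis
    by (rule that) (auto simp: act f_eq inj_on_def)
qed

section \<open>The inductive rank\<close>

lemma iterates_stationary_iff:
  fixes G :: "('a, 'm) monoid_scheme" (structure)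
  assumes "group G" and fin: "finite (carrier G)" and inf: "infinite (UNIV :: 'b set)"
  shows "(\<forall>(A :: 'b set) act c I. pointed_gset G A act c \<longrightarrow> I \<subseteq> A \<longrightarrow> I \<noteq> {} \<longrightarrow>
      (ind_op G A act c ^^ n) I = (ind_op G A act c ^^ (n + 1)) I) \<longleftrightarrow>
    max_sub_pos_diameter G \<le> 2 ^ n - 1" (is "?stationary \<longleftrightarrow> _")
proof -
  interpret group G by (rule assms)
  define p q where "p = (2::nat) ^ n - 1" and "q = (2::nat) ^ (n + 1) - 1"
  have "p < q" unfolding p_def q_def by (simp add: diff_less_mono)
  have "?stationary" if le: "max_sub_pos_diameter G \<le> p"
  proof (intro allI impI)
    fix A :: "'b set" and act c I
    assume "pointed_gset G A act c" and I: "I \<subseteq> A"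
    then interpret pointed_gset G A act c by simp
    let ?T = "point_transporter G act c I"
    have "max_sub_pos_diameter G \<le> q" using le \<open>p < q\<close> by simp
    then have "set_pow_le G ?T p = set_pow_le G ?T q"
      using le point_transporter_carrier by (simp add: max_sub_pos_diameter_le_iff[OF fin])
    then show "(ind_op G A act c ^^ n) I = (ind_op G A act c ^^ (n + 1)) I"
      unfolding ind_op_iterate[OF I] p_def q_def by simp
  qed
  moreover have "max_sub_pos_diameter G \<le> p" if stat: ?stationary
    unfolding max_sub_pos_diameter_le_iff[OF fin]
  proof (intro allI impI)
    fix S assume S: "S \<subseteq> carrier G"
    obtain A :: "'b set" and act c d where "pointed_gset G A act c" and d: "d \<in> A"
      and inj_c: "inj_on (\<lambda>g. act g c) (carrier G)"
      and inj_d: "inj_on (\<lambda>g. act g d) (carrier G)"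
      and disj: "\<And>g h. g \<in> carrier G \<Longrightarrow> h \<in> carrier G \<Longrightarrow> act g c \<noteq> act h d"
      using ex_two_regular_orbits[OF fin inf] by metis
    then interpret pointed_gset G A act c by simp
    define I where "I = insert d ((\<lambda>s. act s c) ` S)"
    have I: "I \<subseteq> A" using S d by (auto simp: I_def intro: act_closed const_closed)
    have "act g c \<noteq> d" if "g \<in> carrier G" for g
      using disj[OF that one_closed] act_one[OF d] by simp
    then have T: "point_transporter G act c I = S"
      using S inj_c by (auto simp: point_transporter_def I_def inj_on_def)
    \<comment> \<open>Only the member \<open>d\<close> of \<open>I\<close> has translates in its orbit, on which the action is free.\<close>
    have trace: "{g \<in> carrier G. act g d \<in> translates act W I} = W"
      if W: "W \<subseteq> carrier G" for W
    proof (intro equalityI subsetI)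
      fix g assume "g \<in> {g \<in> carrier G. act g d \<in> translates act W I}"
      then obtain w i where g: "g \<in> carrier G" and w: "w \<in> W" and i: "i \<in> I"
        and eq: "act g d = act w i"
        by (auto simp: translates_def)
      have wG: "w \<in> carrier G" using w W by blast
      have "i = d"
      proof (rule ccontr)
        assume "i \<noteq> d"
        then obtain s where s: "s \<in> carrier G" "i = act s c"
          using i S by (auto simp: I_def)
        then have "act g d = act (w \<otimes> s) c"
          using eq wG const_closed by (simp add: act_act)
        then show False using disj[of "w \<otimes> s" g] g wG s by simp
      qed
      then show "g \<in> W" using eq inj_d g w wG by (auto dest: inj_onD)
    next
      fix g assume "g \<in> W"
      then show "g \<in> {g \<in> carrier G. act g d \<in> translates act W I}"
        using W by (auto simp: translates_def I_def)
    qed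
    have "(ind_op G A act c ^^ n) I = (ind_op G A act c ^^ (n + 1)) I"
      using stat \<open>pointed_gset G A act c\<close> I by (simp add: I_def)
    then have "translates act (set_pow_le G S p) I = translates act (set_pow_le G S q) I"
      unfolding ind_op_iterate[OF I] T p_def q_def .
    then have "set_pow_le G S p = set_pow_le G S q"
      using trace[OF set_pow_le_carrier[OF S]] by metis
    then show "set_pow_le G S p = generate G S"
      by (rule set_pow_le_eq_generate[OF S fin \<open>p < q\<close>])
  qed
  ultimately show ?thesis unfolding p_def by blast
qed

lemma le_power2_minus_1_iff_ceiling_log:
  "d \<le> 2 ^ n - 1 \<longleftrightarrow> nat \<lceil>log 2 (1 + real d)\<rceil> \<le> n"
proof -
  have "d \<le> 2 ^ n - 1 \<longleftrightarrow> d + 1 \<le> 2 ^ n"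
    using one_le_power[of "2::nat" n] by linarith
  also have "\<dots> \<longleftrightarrow> real (d + 1) \<le> real (2 ^ n)"
    by (simp only: of_nat_le_iff)
  also have "\<dots> \<longleftrightarrow> 1 + real d \<le> 2 powr real n"
    by (simp add: powr_realpow add.commute)
  also have "\<dots> \<longleftrightarrow> log 2 (1 + real d) \<le> real n"
    by (simp add: log_le_iff)
  also have "\<dots> \<longleftrightarrow> nat \<lceil>log 2 (1 + real d)\<rceil> \<le> n"
    by (simp add: nat_le_iff ceiling_le_iff)
  finally show ?thesis .
qed

theorem theorem4p4:
  fixes G :: "('a, 'm) monoid_scheme"
  assumes "group G" and "finite (carrier G)"
    and "infinite (UNIV :: 'b set)"
  shows "inductive_rank TYPE('b) G =
           enat (nat \<lceil>log 2 (1 + real (max_sub_pos_diameter G))\<rceil>)"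
proof -
  let ?r = "nat \<lceil>log 2 (1 + real (max_sub_pos_diameter G))\<rceil>"
  have "inductive_rank TYPE('b) G = Inf (enat ` {n. ?r \<le> n})"
    unfolding inductive_rank_def iterates_stationary_iff[OF assms]
      le_power2_minus_1_iff_ceiling_log ..
  also have "\<dots> = enat ?r"
    by (rule cInf_eq_minimum) auto
  finally show ?thesis .
qed

end
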